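(* Suppose that both $A_1$ and $A_2$ are irreducible nonsingular $M$-matrices and that $\tau_2$ satisfies $$\tau_2<\min\{\lambda_{\min}(\mathcal{A}_{\mathbf v}(\mathbf u)),\lambda_{\min}(\mathcal{B}_{\mathbf u}(\mathbf v))\}-2\max\{\beta_{11},\beta_{22}\}\quad\text{for all unit }\mathbf u,\mathbf v\in\mathbb{R}^n .$$ Let $(\mathbf u_k,\mathbf v_k)$ be the iterates of ANNI. Then, for any step sizes $\theta_k\in(0,1]$ used in the updates of $\mathbf u$ and $\mathbf v$, one has $\mathbf u_k>0$ and $\mathbf v_k>0$ for all $k$.
   Context: Let $n\ge 1$, let $\beta_{11},\beta_{22},\beta_{12}>0$, and let $A_1,A_2\in\mathbb{R}^{n\times n}$ be real symmetric. Consider minimizing $$f(\mathbf u,\mathbf v)=\frac{\beta_{11}}{2}\sum_i u_i^4+\mathbf u^TA_1\mathbf u+\frac{\beta_{22}}{2}\sum_i v_i^4+\mathbf v^TA_2\mathbf v+\beta_{12}\sum_i u_i^2v_i^2$$ over $\mathbf u,\mathbf v\in\mathbb{R}^n$ with $\|\mathbf u\|=\|\mathbf v\|=1$ (Euclidean norm). "Unit" means norm 1; $\mathbf u>0$ means all entries are positive; $\mathbf u^{[m]}$ is the entrywise $m$-th power; $\lambda_{\min}$ is the smallest eigenvalue. $M$-matrix: a real matrix of the form $sI-C$ with $C$ entrywise nonnegative and $s\ge\rho(C)$ (spectral radius). A matrix $(a_{ij})$ is reducible if there is a nonempty proper index subset $I$ with $a_{ij}=0$ for all $i\in I,j\notin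 I$; otherwise irreducible. Define $\mathcal{A}_{\mathbf v}(\mathbf u)=\beta_{11}\mathrm{diag}(\mathbf u^{[2]})+A_1+\beta_{12}\mathrm{diag}(\mathbf v^{[2]})$, $\mathcal{B}_{\mathbf u}(\mathbf v)=\beta_{22}\mathrm{diag}(\mathbf v^{[2]})+A_2+\beta_{12}\mathrm{diag}(\mathbf u^{[2]})$, $J_{\mathbf v}(\mathbf u,\lambda)=\mathcal{A}_{\mathbf v}(\mathbf u)-\lambda I+2\beta_{11}\mathrm{diag}(\mathbf u^{[2]})$, $K_{\mathbf u}(\mathbf v,\mu)=\mathcal{B}_{\mathbf u}(\mathbf v)-\mu I+2\beta_{22}\mathrm{diag}(\mathbf v^{[2]})$, $\mathbf r_{\mathbf v}(\mathbf u,\lambda)=\mathcal{A}_{\mathbf v}(\mathbf u)\mathbf u-\lambda\mathbf u$, $\mathbf s_{\mathbf u}(\mathbf v,\mu)=\mathcal{B}_{\mathbf u}(\mathbf v)\mathbf v-\mu\mathbf v$. ANNI (alternating Newton-Noda iteration): fix reals $\tau_1<\tau_2<\min\{\lambda_{\min}(\mathcal{A}_{\mathbf v}(\mathbf u)),\lambda_{\min}(\mathcal{B}_{\mathbf u}(\mathbf v))\}$ for all unit $\mathbf u,\mathbf v$, and unit starting vectors $\mathbf u_0,\mathbf v_0>0$. For $k=0,1,2,\dots$: (1) select any $\lambda_k\in[\tau_1,\tau_2]$; solve for $(\Delta\mathbf u_k,\delta_k)$ the system $J_{\mathbf v_k}(\mathbf u_k,\lambda_k)\Delta\mathbf u_k-\delta_k\mathbf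 u_k=-\mathbf r_{\mathbf v_k}(\mathbf u_k,\lambda_k)$, $\mathbf u_k^T\Delta\mathbf u_k=0$; with a step size $\theta_k\in(0,1]$ put $\mathbf w_{k+1}=\mathbf u_k+\theta_k\Delta\mathbf u_k$, $\mathbf u_{k+1}=\mathbf w_{k+1}/\|\mathbf w_{k+1}\|$; (2) select any $\mu_k\in[\tau_1,\tau_2]$; solve $K_{\mathbf u_{k+1}}(\mathbf v_k,\mu_k)\Delta\mathbf v_k-\delta_k\mathbf v_k=-\mathbf s_{\mathbf u_{k+1}}(\mathbf v_k,\mu_k)$, $\mathbf v_k^T\Delta\mathbf v_k=0$ (with its own scalar $\delta_k$); with a step size $\theta_k\in(0,1]$ put $\mathbf z_{k+1}=\mathbf v_k+\theta_k\Delta\mathbf v_k$, $\mathbf v_{k+1}=\mathbf z_{k+1}/\|\mathbf z_{k+1}\|$. (In the algorithm $\theta_k$ is obtained by halving from $1$ until the objective strictly decreases; here it may be any element of $(0,1]$.) *)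

theory Defs
  imports "HOL-Analysis.Analysis"
begin

definition eigenvalue :: "'a::field ^ 'n ^ 'n \<Rightarrow> 'a \<Rightarrow> bool" where
  "eigenvalue A z \<longleftrightarrow> (\<exists>x. x \<noteq> 0 \<and> A *v x = z *s x)"

text \<open>Only used for real symmetric matrices, whose eigenvalues are all real and exist.\<close>

definition lambda_min :: "real ^ 'n ^ 'n \<Rightarrow> real" where
  "lambda_min A = Min {l. eigenvalue A l}"

text \<open>The eigenvalues of a real matrix are taken over the complex numbers.\<close>

definition spectral_radius :: "real ^ 'n ^ 'n \<Rightarrow> real" where
  "spectral_radius C = Max (cmod ` {z. eigenvalue (map_matrix complex_of_real C) z})"

definition M_matrix :: "real ^ 'n ^ 'n \<Rightarrow> bool" where
  "M_matrix A \<longleftrightarrow>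
     (\<exists>s C. (\<forall>i j. 0 \<le> C $ i $ j) \<and> spectral_radius C \<le> s \<and> A = s *\<^sub>R mat 1 - C)"

definition reducible_matrix :: "real ^ 'n ^ 'n \<Rightarrow> bool" where
  "reducible_matrix A \<longleftrightarrow>
     (\<exists>I. I \<noteq> {} \<and> I \<noteq> UNIV \<and> (\<forall>i\<in>I. \<forall>j\<in>- I. A $ i $ j = 0))"

definition diag :: "real ^ 'n \<Rightarrow> real ^ 'n ^ 'n" where
  "diag x = (\<chi> i j. if i = j then x $ i else 0)"

definition vpow :: "real ^ 'n \<Rightarrow> nat \<Rightarrow> real ^ 'n" where
  "vpow x m = (\<chi> i. x $ i ^ m)"

text \<open>The two blocks of the problem have the same shape, so each of the following notions is
  defined once, for a block with intra-block coefficient \<open>b\<close>, coupling coefficient \<open>c\<close>, matrix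
  \<open>A\<close>, current vector \<open>x\<close> and frozen vector \<open>w\<close> of the other block.  Thus
  \<open>\<A>\<^sub>v(u)\<close> is \<open>block_matrix \<beta>11 \<beta>12 A1 v u\<close> and \<open>\<B>\<^sub>u(v)\<close> is
  \<open>block_matrix \<beta>22 \<beta>12 A2 u v\<close>; in the same way \<open>block_jacobian\<close> gives \<open>J\<^sub>v(u, \<lambda>)\<close> and
  \<open>K\<^sub>u(v, \<mu>)\<close>, and \<open>block_residual\<close> gives \<open>r\<^sub>v(u, \<lambda>)\<close> and \<open>s\<^sub>u(v, \<mu>)\<close>.\<close>

definition block_matrix ::
    "real \<Rightarrow> real \<Rightarrow> real ^ 'n ^ 'n \<Rightarrow> real ^ 'n \<Rightarrow> real ^ 'n \<Rightarrow> real ^ 'n ^ 'n" where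
  "block_matrix b c A w x = b *\<^sub>R diag (vpow x 2) + A + c *\<^sub>R diag (vpow w 2)"

definition block_jacobian ::
    "real \<Rightarrow> real \<Rightarrow> real ^ 'n ^ 'n \<Rightarrow> real ^ 'n \<Rightarrow> real ^ 'n \<Rightarrow> real \<Rightarrow> real ^ 'n ^ 'n" where
  "block_jacobian b c A w x l =
     block_matrix b c A w x - l *\<^sub>R mat 1 + (2 * b) *\<^sub>R diag (vpow x 2)"

definition block_residual ::
    "real \<Rightarrow> real \<Rightarrow> real ^ 'n ^ 'n \<Rightarrow> real ^ 'n \<Rightarrow> real ^ 'n \<Rightarrow> real \<Rightarrow> real ^ 'n" where
  "block_residual b c A w x l = block_matrix b c A w x *v x - l *\<^sub>R x"

text \<open>One damped Newton--Noda update of \<open>x\<close> to \<open>x'\<close> with shift \<open>l\<close> and step size \<open>t\<close>.\<close>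

definition noda_step ::
    "real \<Rightarrow> real \<Rightarrow> real ^ 'n ^ 'n \<Rightarrow> real ^ 'n \<Rightarrow> real \<Rightarrow> real \<Rightarrow> real ^ 'n \<Rightarrow> real ^ 'n \<Rightarrow> bool" where
  "noda_step b c A w l t x x' \<longleftrightarrow>
     (\<exists>\<Delta> \<delta>. block_jacobian b c A w x l *v \<Delta> - \<delta> *\<^sub>R x = - block_residual b c A w x l \<and>
            x \<bullet> \<Delta> = 0 \<and>
            (let y = x + t *\<^sub>R \<Delta> in x' = (1 / norm y) *\<^sub>R y))"

text \<open>The sequences \<open>u\<close>, \<open>v\<close> are iterates of the alternating Newton--Noda iteration with shifts
  \<open>lam k\<close>, \<open>mu k\<close> and step sizes \<open>th k\<close> (for \<open>u\<close>) and \<open>et k\<close> (for \<open>v\<close>).  The update of \<open>v\<close>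
  already uses the new \<open>u (Suc k)\<close>.\<close>

definition ANNI ::
    "real \<Rightarrow> real \<Rightarrow> real \<Rightarrow> real ^ 'n ^ 'n \<Rightarrow> real ^ 'n ^ 'n \<Rightarrow> real \<Rightarrow> real \<Rightarrow>
     (nat \<Rightarrow> real) \<Rightarrow> (nat \<Rightarrow> real) \<Rightarrow> (nat \<Rightarrow> real) \<Rightarrow> (nat \<Rightarrow> real) \<Rightarrow>
     (nat \<Rightarrow> real ^ 'n) \<Rightarrow> (nat \<Rightarrow> real ^ 'n) \<Rightarrow> bool" where
  "ANNI \<beta>11 \<beta>22 \<beta>12 A1 A2 \<tau>1 \<tau>2 lam mu th et u v \<longleftrightarrow>
     \<tau>1 < \<tau>2 \<and>
     (\<forall>x y. norm x = 1 \<longrightarrow> norm y = 1 \<longrightarrow>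
        \<tau>2 < min (lambda_min (block_matrix \<beta>11 \<beta>12 A1 y x))
                 (lambda_min (block_matrix \<beta>22 \<beta>12 A2 x y))) \<and>
     norm (u 0) = 1 \<and> (\<forall>i. 0 < u 0 $ i) \<and>
     norm (v 0) = 1 \<and> (\<forall>i. 0 < v 0 $ i) \<and>
     (\<forall>k. lam k \<in> {\<tau>1..\<tau>2} \<and> mu k \<in> {\<tau>1..\<tau>2} \<and>
          th k \<in> {0<..1} \<and> et k \<in> {0<..1} \<and>
          noda_step \<beta>11 \<beta>12 A1 (v k) (lam k) (th k) (u k) (u (Suc k)) \<and>
          noda_step \<beta>22 \<beta>12 A2 (u (Suc k)) (mu k) (et k) (v k) (v (Suc k)))"

end

theory Submission
  imports Defs
begin

text \<open>With \<open>w = x + \<Delta>\<close>, the Newton--Noda system reads \<open>J w = \<delta> x + 2 b x\<^sup>3\<close> (entrywise cube) and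
  \<open>x \<bullet> w = 1\<close>.  The assumption on \<open>\<tau>\<^sub>2\<close> makes \<open>J\<close> a matrix with nonpositive off-diagonal entries and
  \<open>J \<succ> 2 b I\<close>.  Pairing the system with \<open>w\<close> gives \<open>2 b \<parallel>w\<parallel>\<^sup>2 < \<delta> + 2 b \<parallel>w\<parallel>\<close>; as \<open>\<parallel>w\<parallel> \<ge> 1\<close>, this forces
  \<open>\<delta> > 0\<close>.  Hence \<open>J w > 0\<close>, so \<open>w > 0\<close>, and the damped update, before normalization, is a convex
  combination of \<open>x\<close> and \<open>w\<close>.\<close>

section \<open>The smallest eigenvalue as a lower bound of the quadratic form\<close>

lemma symmetric_matrix_dot:
  fixes A :: "real ^ 'n ^ 'n"
  assumes "transpose A = A"
  shows "(A *v x) \<bullet> y = x \<bullet> (A *v y)"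
  by (metis assms dot_lmul_matrix transpose_matrix_vector)

text \<open>Eigenvectors of distinct eigenvalues are orthogonal, hence independent. Finiteness is
  what makes the \<open>Min\<close> in \<open>lambda_min\<close> usable through
  \<open>Min_le\<close>.\<close>

lemma finite_eigenvalues_symmetric:
  fixes A :: "real ^ 'n ^ 'n"
  assumes sym: "transpose A = A"
  shows "finite {l. eigenvalue A l}"
proof -
  let ?E = "{l. eigenvalue A l}"
  have "\<forall>l\<in>?E. \<exists>x. x \<noteq> 0 \<and> A *v x = l *\<^sub>R x"
    by (auto simp: eigenvalue_def scalar_mult_eq_scaleR)
  then obtain e where e: "\<And>l. l \<in> ?E \<Longrightarrow> e l \<noteq> 0 \<and> A *v e l = l *\<^sub>R e l"
    by metis
  have orth: "e k \<bullet> e l = 0" if "k \<in> ?E" "l \<in> ?E" "k \<noteq> l" for k l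
  proof -
    have "k * (e k \<bullet> e l) = l * (e k \<bullet> e l)"
      using symmetric_matrix_dot[OF sym, of "e k" "e l"] e that by simp
    then show ?thesis using that by simp
  qed
  have "inj_on e ?E"
    by (rule inj_onI) (metis e orth inner_eq_zero_iff)
  moreover have "pairwise orthogonal (e ` ?E)"
    unfolding pairwise_def orthogonal_def using orth by auto
  moreover have "0 \<notin> e ` ?E" using e by auto
  ultimately show ?thesis
    using pairwise_orthogonal_independent independent_imp_finite finite_imageD by metis
qed

text \<open>The form \<open>y \<bullet> (A *v y) - m * (y \<bullet> y)\<close> is nonnegative and
  vanishes at \<open>x\<close>, so its first variation there vanishes too; otherwise a small move
  against the residual \<open>z\<close> would make it negative.\<close>

lemma minimal_quadratic_form_eigenvector:
  fixes A :: "real ^ 'n ^ 'n"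
  assumes sym: "transpose A = A"
    and lower: "\<And>y. m * (y \<bullet> y) \<le> y \<bullet> (A *v y)"
    and eq: "x \<bullet> (A *v x) = m * (x \<bullet> x)"
  shows "A *v x = m *\<^sub>R x"
proof (rule ccontr)
  define z where "z = A *v x - m *\<^sub>R x"
  define c where "c = z \<bullet> (A *v z) - m * (z \<bullet> z)"
  assume "\<not> ?thesis"
  then have a: "0 < z \<bullet> z" by (simp add: z_def)
  have c: "0 \<le> c" using lower[of z] by (simp add: c_def)
  \<comment> \<open>Along \<open>x + t *\<^sub>R z\<close> the form is
    \<open>2 * t * (z \<bullet> z) + t\<^sup>2 * c\<close>. This \<open>t\<close> is small enough
    for the linear term to dominate; the \<open>+ 1\<close> covers \<open>c = 0\<close>.\<close>
  define t where "t = - (z \<bullet> z) / (c + 1)"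
  have "x \<bullet> (A *v z) = z \<bullet> (A *v x)"
    by (metis symmetric_matrix_dot[OF sym] inner_commute)
  moreover have "z \<bullet> (A *v x) - m * (z \<bullet> x) = z \<bullet> z"
    by (simp add: z_def algebra_simps)
  ultimately have "(x + t *\<^sub>R z) \<bullet> (A *v (x + t *\<^sub>R z)) - m * ((x + t *\<^sub>R z) \<bullet> (x + t *\<^sub>R z))
      = 2 * t * (z \<bullet> z) + t\<^sup>2 * c"
    using eq by (simp add: c_def matrix_vector_right_distrib matrix_vector_mult_scaleR
        inner_commute algebra_simps power2_eq_square)
  then have "0 \<le> t * (2 * (z \<bullet> z) + t * c)"
    using lower[of "x + t *\<^sub>R z"] by (simp add: algebra_simps power2_eq_square)
  moreover have "t < 0" using a c by (simp add: t_def)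
  moreover have "2 * (z \<bullet> z) + t * c > 0"
  proof -
    have "- t * c \<le> z \<bullet> z"
      using a c by (simp add: t_def field_simps)
    then show ?thesis using a by linarith
  qed
  ultimately show False using mult_neg_pos[of t "2 * (z \<bullet> z) + t * c"] by linarith
qed

text \<open>By compactness the form has a minimum \<open>m\<close> on the unit sphere. Its minimizer
  is an eigenvector, so \<open>m\<close> is an eigenvalue and bounds \<open>lambda_min A\<close>
  from above; homogeneity extends the bound to all \<open>y\<close>.\<close>

lemma lambda_min_le_quadratic_form:
  fixes A :: "real ^ 'n ^ 'n"
  assumes sym: "transpose A = A"
  shows "lambda_min A * (y \<bullet> y) \<le> y \<bullet> (A *v y)"
proof -
  have "\<exists>x\<in>sphere 0 1. \<forall>y\<in>sphere 0 1. x \<bullet> (A *v x) \<le> y \<bullet> (A *v y)"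
    by (intro continuous_attains_inf continuous_intros matrix_vector_mult_linear_continuous_on) auto
  then obtain x where x: "norm x = 1"
    and min: "\<And>y. norm y = 1 \<Longrightarrow> x \<bullet> (A *v x) \<le> y \<bullet> (A *v y)" by auto
  define m where "m = x \<bullet> (A *v x)"
  have lower: "m * (y \<bullet> y) \<le> y \<bullet> (A *v y)" for y
  proof (cases "y = 0")
    case False
    have "m \<le> (y /\<^sub>R norm y) \<bullet> (A *v (y /\<^sub>R norm y))"
      unfolding m_def using False by (intro min) simp
    also have "\<dots> = (y \<bullet> (A *v y)) / (norm y)\<^sup>2"
      by (simp add: matrix_vector_mult_scaleR power2_eq_square field_simps)
    finally show ?thesis
      using False by (simp add: field_simps power2_norm_eq_inner)
  qed simp
  have "A *v x = m *\<^sub>R x"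
    using x by (intro minimal_quadratic_form_eigenvector sym lower)
      (simp add: m_def norm_eq_1)
  then have "eigenvalue A m"
    unfolding eigenvalue_def scalar_mult_eq_scaleR using x by (intro exI[of _ x]) auto
  then have "lambda_min A \<le> m"
    unfolding lambda_min_def using finite_eigenvalues_symmetric[OF sym] by (intro Min_le) auto
  then show ?thesis
    using lower[of y] mult_right_mono[of "lambda_min A" m "y \<bullet> y"] by simp
qed

section \<open>Block matrices and their Jacobians\<close>

lemma diag_mult_vec: "diag d *v x = (\<chi> i. d $ i * x $ i)"
  by (simp add: diag_def matrix_vector_mult_def vec_eq_iff if_distrib[of "\<lambda>a. a * _"] cong: if_cong)

lemma transpose_block_matrix:
  assumes "transpose A = A"
  shows "transpose (block_matrix b c A w x) = block_matrix b c A w x"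
  using assms by (auto simp: block_matrix_def transpose_def diag_def vec_eq_iff)

lemma M_matrix_offdiag_nonpos:
  assumes "M_matrix A" "i \<noteq> j"
  shows "A $ i $ j \<le> 0"
  using assms by (auto simp: M_matrix_def mat_def)

lemma block_jacobian_offdiag:
  assumes "i \<noteq> j"
  shows "block_jacobian b c A w x l $ i $ j = A $ i $ j"
  using assms by (simp add: block_jacobian_def block_matrix_def diag_def mat_def)

lemma block_jacobian_mult_vec:
  "block_jacobian b c A w x l *v y =
     block_matrix b c A w x *v y - l *\<^sub>R y + (2 * b) *\<^sub>R (\<chi> i. (x $ i)\<^sup>2 * y $ i)"
  by (simp add: block_jacobian_def matrix_vector_mult_add_rdistrib matrix_vector_mult_diff_rdistrib
      scaleR_matrix_vector_assoc[symmetric] diag_mult_vec vpow_def)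

text \<open>Inverse positivity, the step that turns \<open>J w > 0\<close> into
  \<open>w > 0\<close>.\<close>

lemma pos_if_mult_vec_pos:
  fixes J :: "real ^ 'n ^ 'n"
  assumes off: "\<And>i j. i \<noteq> j \<Longrightarrow> J $ i $ j \<le> 0"
    and pd: "\<And>y. y \<noteq> 0 \<Longrightarrow> 0 < y \<bullet> (J *v y)"
    and pos: "\<And>i. 0 < (J *v w) $ i"
  shows "0 < w $ i"
proof -
  \<comment> \<open>Testing \<open>J w\<close> against the negative part of \<open>w\<close> shows that this part vanishes.\<close>
  define p where "p = (\<chi> i. max 0 (- w $ i))"
  have "p = 0"
  proof (rule ccontr)
    assume "p \<noteq> 0"
    \<comment> \<open>\<open>w + p\<close> is the positive part of \<open>w\<close>. Its support is
      disjoint from that of \<open>p\<close>, so only off-diagonal entries of \<open>J\<close>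
      contribute.\<close>
    have "p \<bullet> (J *v (w + p)) \<le> 0"
    proof -
      have "p $ i * (J $ i $ j * (w $ j + p $ j)) \<le> 0" for i j
      proof (cases "i = j")
        case True
        then show ?thesis by (simp add: p_def max_def)
      next
        case False
        then have "J $ i $ j * (w $ j + p $ j) \<le> 0"
          by (intro mult_nonpos_nonneg off) (auto simp: p_def)
        then show ?thesis by (simp add: p_def mult_nonneg_nonpos)
      qed
      then show ?thesis
        by (simp add: inner_vec_def matrix_vector_mult_def sum_distrib_left sum_nonpos)
    qed
    moreover have "0 \<le> p \<bullet> (J *v w)"
      unfolding inner_vec_def
      by (intro sum_nonneg) (simp add: p_def less_imp_le[OF pos])
    ultimately show False
      using pd[OF \<open>p \<noteq> 0\<close>] by (simp add: matrix_vector_right_distrib inner_add_right)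
  qed
  then have nonneg: "0 \<le> w $ j" for j
    by (auto simp: p_def vec_eq_iff max_def split: if_splits dest: spec[of _ j])
  \<comment> \<open>At a zero of \<open>w\<close> the diagonal term of row \<open>i\<close> drops
    out, leaving only nonpositive terms.\<close>
  have "w $ i \<noteq> 0"
  proof
    assume "w $ i = 0"
    then have "J $ i $ j * w $ j \<le> 0" for j
      using off[of i j] nonneg[of j] by (cases "i = j") (auto simp: mult_nonpos_nonneg)
    then have "(J *v w) $ i \<le> 0"
      by (simp add: matrix_vector_mult_def sum_nonpos)
    then show False using pos[of i] by simp
  qed
  then show ?thesis using nonneg[of i] by simp
qed

lemma norm_cube_le:
  fixes x :: "real ^ 'n"
  assumes "norm x = 1"
  shows "norm (vpow x 3) \<le> 1"
proof -
  have "norm (vpow x 3) \<le> norm x"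
  proof (rule norm_le_componentwise_cart)
    fix i
    have "\<bar>x $ i\<bar> \<le> 1" using component_le_norm_cart[of x i] assms by simp
    then have "\<bar>x $ i\<bar> ^ 3 \<le> \<bar>x $ i\<bar>"
      using power_decreasing[of 1 3 "\<bar>x $ i\<bar>"] by simp
    then show "norm (vpow x 3 $ i) \<le> norm (x $ i)" by (simp add: vpow_def power_abs)
  qed
  then show ?thesis using assms by simp
qed

text \<open>Both updates of the iteration are instances of this. The unit norm is part of the
  conclusion so that the step can be iterated.\<close>

lemma noda_step_pos:
  fixes A :: "real ^ 'n ^ 'n"
  assumes b: "0 < b" and sym: "transpose A = A" and M: "M_matrix A"
    and x: "norm x = 1" "\<And>i. 0 < x $ i"
    and gap: "l + 2 * b < lambda_min (block_matrix b c A w x)"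
    and t: "t \<in> {0<..1}"
    and step: "noda_step b c A w l t x x'"
  shows "norm x' = 1 \<and> (\<forall>i. 0 < x' $ i)"
proof -
  let ?B = "block_matrix b c A w x" and ?J = "block_jacobian b c A w x l"
  obtain \<Delta> \<delta> where sys: "?J *v \<Delta> - \<delta> *\<^sub>R x = - block_residual b c A w x l"
    and orth: "x \<bullet> \<Delta> = 0"
    and x': "x' = (1 / norm (x + t *\<^sub>R \<Delta>)) *\<^sub>R (x + t *\<^sub>R \<Delta>)"
    using step unfolding noda_step_def Let_def by blast
  define y where "y = x + \<Delta>"
  \<comment> \<open>The extra diagonal term of the Jacobian produces the cube; the residual cancels
    once the Newton system is added.\<close>
  have "?J *v x = block_residual b c A w x l + (2 * b) *\<^sub>R vpow x 3"
    by (simp add: block_jacobian_mult_vec block_residual_def vpow_def power2_eq_square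
        power3_eq_cube)
  then have Jy: "?J *v y = \<delta> *\<^sub>R x + (2 * b) *\<^sub>R vpow x 3"
    using sys by (simp add: y_def matrix_vector_right_distrib algebra_simps)
  have xy: "x \<bullet> y = 1"
    using orth x(1) by (simp add: y_def inner_add_right norm_eq_1)
  have J: "2 * b * (z \<bullet> z) < z \<bullet> (?J *v z)" if "z \<noteq> 0" for z
  proof -
    have "(l + 2 * b) * (z \<bullet> z) < lambda_min ?B * (z \<bullet> z)"
      using gap that by simp
    also have "\<dots> \<le> z \<bullet> (?B *v z)"
      by (intro lambda_min_le_quadratic_form transpose_block_matrix sym)
    finally have "2 * b * (z \<bullet> z) < z \<bullet> (?B *v z) - l * (z \<bullet> z)"
      by (simp add: algebra_simps)
    moreover have "0 \<le> 2 * b * (z \<bullet> (\<chi> i. (x $ i)\<^sup>2 * z $ i))"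
    proof -
      have "0 \<le> z \<bullet> (\<chi> i. (x $ i)\<^sup>2 * z $ i)"
        unfolding inner_vec_def by (intro sum_nonneg) (simp add: mult.left_commute[of "z $ _"])
      then show ?thesis using b by simp
    qed
    moreover have "z \<bullet> (?J *v z) = z \<bullet> (?B *v z) - l * (z \<bullet> z)
        + 2 * b * (z \<bullet> (\<chi> i. (x $ i)\<^sup>2 * z $ i))"
      by (simp add: block_jacobian_mult_vec inner_add_right inner_diff_right)
    ultimately show ?thesis by linarith
  qed
  have "0 < \<delta>"
  proof -
    have "y \<noteq> 0" using xy by auto
    have ge1: "1 \<le> norm y" using Cauchy_Schwarz_ineq2[of x y] xy x(1) by simp
    have "2 * b * (norm y * norm y) = 2 * b * (y \<bullet> y)"
      by (simp add: dot_square_norm power2_eq_square)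
    also have "\<dots> < y \<bullet> (?J *v y)" by (rule J) fact
    also have "\<dots> = \<delta> + 2 * b * (y \<bullet> vpow x 3)"
      using xy by (simp add: Jy inner_add_right inner_commute)
    also have "y \<bullet> vpow x 3 \<le> norm y * norm (vpow x 3)"
      by (rule norm_cauchy_schwarz)
    also have "\<dots> \<le> norm y * 1"
      by (intro mult_left_mono norm_cube_le x) simp
    \<comment> \<open>Raising the linear term to a quadratic one makes it cancel against the
      left-hand side, leaving \<open>0 < \<delta>\<close>.\<close>
    also have "\<dots> \<le> norm y * norm y"
      using ge1 by (intro mult_left_mono) auto
    finally show ?thesis using b by simp
  qed
  then have "0 < (?J *v y) $ i" for i
    using b x(2)[of i] by (simp add: Jy vpow_def add_pos_pos)
  moreover have "0 < z \<bullet> (?J *v z)" if "z \<noteq> 0" for z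
  proof -
    have "0 \<le> 2 * b * (z \<bullet> z)" using b by simp
    then show ?thesis using J[OF that] by linarith
  qed
  ultimately have y: "0 < y $ i" for i
    by (intro pos_if_mult_vec_pos[where J = ?J and w = y])
      (simp_all add: block_jacobian_offdiag M_matrix_offdiag_nonpos[OF M])
  have "x + t *\<^sub>R \<Delta> = (1 - t) *\<^sub>R x + t *\<^sub>R y"
    by (simp add: y_def algebra_simps)
  \<comment> \<open>For \<open>t = 1\<close> the weight of \<open>x\<close> is zero, so strictness
    comes from the term in \<open>y\<close>, whose weight \<open>t\<close> is positive.\<close>
  then have pos: "0 < (x + t *\<^sub>R \<Delta>) $ i" for i
    using t x(2)[of i] y[of i] by (simp add: add_nonneg_pos)
  then have "x + t *\<^sub>R \<Delta> \<noteq> 0"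
    by (metis less_irrefl zero_index)
  then show ?thesis
    using pos unfolding x' by simp
qed

theorem theorem4p5:
  fixes \<beta>11 \<beta>22 \<beta>12 \<tau>1 \<tau>2 :: real
    and A1 A2 :: "real ^ 'n ^ 'n"
    and lam mu th et :: "nat \<Rightarrow> real"
    and u v :: "nat \<Rightarrow> real ^ 'n"
  assumes "0 < \<beta>11" and "0 < \<beta>22" and "0 < \<beta>12"
    and "transpose A1 = A1" and "transpose A2 = A2"
    and "M_matrix A1" and "invertible A1" and "\<not> reducible_matrix A1"
    and "M_matrix A2" and "invertible A2" and "\<not> reducible_matrix A2"
    and "\<And>x y :: real ^ 'n. norm x = 1 \<Longrightarrow> norm y = 1 \<Longrightarrow>
           \<tau>2 < min (lambda_min (block_matrix \<beta>11 \<beta>12 A1 y x))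
                    (lambda_min (block_matrix \<beta>22 \<beta>12 A2 x y)) - 2 * max \<beta>11 \<beta>22"
    and "ANNI \<beta>11 \<beta>22 \<beta>12 A1 A2 \<tau>1 \<tau>2 lam mu th et u v"
  shows "\<forall>k. (\<forall>i. 0 < u k $ i) \<and> (\<forall>i. 0 < v k $ i)"
proof -
  have init: "norm (u 0) = 1" "\<forall>i. 0 < u 0 $ i" "norm (v 0) = 1" "\<forall>i. 0 < v 0 $ i"
    and shift: "\<And>k. lam k \<le> \<tau>2" "\<And>k. mu k \<le> \<tau>2"
    and size: "\<And>k. th k \<in> {0<..1}" "\<And>k. et k \<in> {0<..1}"
    and step: "\<And>k. noda_step \<beta>11 \<beta>12 A1 (v k) (lam k) (th k) (u k) (u (Suc k))"
      "\<And>k. noda_step \<beta>22 \<beta>12 A2 (u (Suc k)) (mu k) (et k) (v k) (v (Suc k))"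
    using assms(13) by (auto simp: ANNI_def)
  have gap: "\<tau>2 + 2 * \<beta>11 < lambda_min (block_matrix \<beta>11 \<beta>12 A1 y x)"
    "\<tau>2 + 2 * \<beta>22 < lambda_min (block_matrix \<beta>22 \<beta>12 A2 x y)"
    if "norm x = 1" "norm y = 1" for x y
    using assms(12)[OF that] by auto
  \<comment> \<open>Unit norms are carried along because \<open>gap\<close> speaks of unit vectors
    only.\<close>
  have "(norm (u k) = 1 \<and> (\<forall>i. 0 < u k $ i)) \<and> (norm (v k) = 1 \<and> (\<forall>i. 0 < v k $ i))" for k
  proof (induction k)
    case 0
    then show ?case using init by simp
  next
    case (Suc k)
    have u: "norm (u (Suc k)) = 1 \<and> (\<forall>i. 0 < u (Suc k) $ i)"
    proof (rule noda_step_pos[OF assms(1,4,6) _ _ _ size(1) step(1)])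
      show "lam k + 2 * \<beta>11 < lambda_min (block_matrix \<beta>11 \<beta>12 A1 (v k) (u k))"
        using gap(1)[of "u k" "v k"] shift(1)[of k] Suc by simp
    qed (use Suc in auto)
    moreover have "norm (v (Suc k)) = 1 \<and> (\<forall>i. 0 < v (Suc k) $ i)"
    proof (rule noda_step_pos[OF assms(2,5,9) _ _ _ size(2) step(2)])
      show "mu k + 2 * \<beta>22 < lambda_min (block_matrix \<beta>22 \<beta>12 A2 (u (Suc k)) (v k))"
        using gap(2)[of "u (Suc k)" "v k"] shift(2)[of k] Suc u by simp
    qed (use Suc in auto)
    ultimately show ?case by simp
  qed
  then show ?thesis by blast
qed

end
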